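(* Let $G$ be a non-abelian group and let $k:G\to\mathbb{N}\cup\{0\}$ be a class assigned function on $G$. Let $g:G\to G$ be the function given by $g(w)=w^{k(w)}$. Then $S_g=\{(g(x),x)\mid x\in G\}$ is a gyrotransversal to the subgroup $G\times\{1\}$ in the group $(G\times G,\cdot)$. Moreover, define a binary operation $o_k$ on $G$ by $$x\, o_k\, y = y^{-k(y)}\,x\,y^{k(y)+1}\qquad (x,y\in G).$$ Then $(G,o_k)$ is a right gyrogroup.
   Context: For a group $G$, let $R$ be the equivalence relation on $G$ given by: $aRb$ if $a=b$, or $a=b^{-1}$, or $a$ is conjugate to $b$ in $G$, or $a$ is conjugate to $b^{-1}$ in $G$. The class of $w$ is denoted $[w]_R$. A function $k:G\to\mathbb{N}\cup\{0\}$ is called a class assigned function on $G$ if $k$ is constant on each class $[w]_R$ and takes the value $0$ on $[1]_R$, where $1$ is the identity of $G$. For a group $G$ with identity $1$, the set $G\times G$ is equipped with the binary operation $$(a,x)\cdot(b,y)=\bigl(ab\,[b^{-1}xb,\,y^{-1}],\ (b^{-1}xb)\circ y\bigr),$$ where $x\circ y=y^{-1}xy^2$ and $[u,v]=uvu^{-1}v^{-1}$. With this operation $G\times G$ is a group (not the direct product) with identity $(1,1)$, and $G\times\{1\}$ is a subgroup isomorphic to $G$. A right transversal to a subgroup $H$ in a group $\Gamma$ is a subset $S\subseteq\Gamma$ containing exactly one element of each right coset $H\gamma$ of $H$; a right transversal with identity is one that contains the identity of $\Gamma$. A right transversal $S$ with identity to $H$ in $\Gamma$ is called a gyrotransversal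 if $S=S^{-1}$ and $h^{-1}sh\in S$ for all $s\in S$ and $h\in H$; here inverses and products are those of $\Gamma$. Right gyrogroup: let $(S,o)$ be a magma together with a right identity $e$ and a right inverse $a'$ for every $a\in S$ with respect to $e$, i.e. $a\,o\,a'=e$. Then $(S,o)$ is called a right gyrogroup if (1) for any $x,y,z\in S$ there exists a unique element $f(y,z)(x)\in S$ such that $(x\,o\,y)\,o\,z=f(y,z)(x)\,o\,(y\,o\,z)$; (2) for all $y,z\in S$ the map $f(y,z):S\to S$, $x\mapsto f(y,z)(x)$, is an automorphism of $(S,o)$; and (3) $f(y,y')=I_S$ (the identity map of $S$) for all $y\in S$. *)

theory Defs
  imports "HOL-Algebra.Coset"
begin

context
  fixes G :: "('a, 'b) monoid_scheme" (structure)
begin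

definition conjugate :: "'a \<Rightarrow> 'a \<Rightarrow> bool" where
  "conjugate a b \<longleftrightarrow> (\<exists>h\<in>carrier G. a = inv h \<otimes> b \<otimes> h)"

definition conj_inv_rel :: "('a \<times> 'a) set" where
  "conj_inv_rel = {(a, b). a \<in> carrier G \<and> b \<in> carrier G \<and>
     (a = b \<or> a = inv b \<or> conjugate a b \<or> conjugate a (inv b))}"

definition class_assigned :: "('a \<Rightarrow> nat) \<Rightarrow> bool" where
  "class_assigned k \<longleftrightarrow>
     (\<forall>C\<in>carrier G // conj_inv_rel. \<forall>a\<in>C. \<forall>b\<in>C. k a = k b) \<and>
     (\<forall>a\<in>conj_inv_rel `` {\<one>}. k a = 0)"

definition commutator :: "'a \<Rightarrow> 'a \<Rightarrow> 'a" where
  "commutator u v = u \<otimes> v \<otimes> inv u \<otimes> inv v"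

definition circ :: "'a \<Rightarrow> 'a \<Rightarrow> 'a" where
  "circ x y = inv y \<otimes> x \<otimes> y [^] (2::nat)"

definition pair_group :: "('a \<times> 'a) monoid" where
  "pair_group =
     \<lparr>carrier = carrier G \<times> carrier G,
      mult = (\<lambda>(a, x) (b, y).
        (a \<otimes> b \<otimes> commutator (inv b \<otimes> x \<otimes> b) (inv y), circ (inv b \<otimes> x \<otimes> b) y)),
      one = (\<one>, \<one>)\<rparr>"

definition right_transversal :: "'a set \<Rightarrow> 'a set \<Rightarrow> bool" where
  "right_transversal H S \<longleftrightarrow>
     group G \<and> subgroup H G \<and> S \<subseteq> carrier G \<and> (\<forall>C\<in>rcosets H. \<exists>!s. s \<in> S \<inter> C)"

definition gyrotransversal :: "'a set \<Rightarrow> 'a set \<Rightarrow> bool" where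
  "gyrotransversal H S \<longleftrightarrow>
     right_transversal H S \<and> \<one> \<in> S \<and> S = set_inv S \<and>
     (\<forall>s\<in>S. \<forall>h\<in>H. inv h \<otimes> s \<otimes> h \<in> S)"

end

text \<open>
  A magma with right identity is represented by the record type of HOL-Algebra monoids,
  without assuming the monoid laws. The choice in \<open>gyr\<close> is used only under the
  unique existence required by \<open>right_gyrogroup\<close>.
\<close>

context
  fixes S :: "('a, 'b) monoid_scheme" (structure)
begin

definition gyr :: "'a \<Rightarrow> 'a \<Rightarrow> 'a \<Rightarrow> 'a" where
  "gyr y z x = (THE u. u \<in> carrier S \<and> (x \<otimes> y) \<otimes> z = u \<otimes> (y \<otimes> z))"

definition right_gyrogroup :: bool where
  "right_gyrogroup \<longleftrightarrow>
     (\<forall>x\<in>carrier S. \<forall>y\<in>carrier S. x \<otimes> y \<in> carrier S) \<and>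
     \<one> \<in> carrier S \<and> (\<forall>x\<in>carrier S. x \<otimes> \<one> = x) \<and>
     (\<exists>rinv \<in> carrier S \<rightarrow> carrier S.
        (\<forall>a\<in>carrier S. a \<otimes> rinv a = \<one>) \<and>
        (\<forall>x\<in>carrier S. \<forall>y\<in>carrier S. \<forall>z\<in>carrier S.
           \<exists>!u. u \<in> carrier S \<and> (x \<otimes> y) \<otimes> z = u \<otimes> (y \<otimes> z)) \<and>
        (\<forall>y\<in>carrier S. \<forall>z\<in>carrier S. gyr y z \<in> iso S S) \<and>
        (\<forall>y\<in>carrier S. \<forall>x\<in>carrier S. gyr y (rinv y) x = x))"

end

definition gyro_op_magma :: "('a, 'b) monoid_scheme \<Rightarrow> ('a \<Rightarrow> nat) \<Rightarrow> 'a monoid" where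
  "gyro_op_magma G k =
     \<lparr>carrier = carrier G,
      mult = (\<lambda>x y. y [^]\<^bsub>G\<^esub> (- int (k y)) \<otimes>\<^bsub>G\<^esub> x \<otimes>\<^bsub>G\<^esub> y [^]\<^bsub>G\<^esub> (k y + 1)),
      one = \<one>\<^bsub>G\<^esub>\<rparr>"

end

theory Submission
  imports Defs
begin

text \<open>
  Two hidden identifications make both claims transparent.

  The operation on pairs is the direct product \<open>G \<times> G\<close> in disguise: both \<open>(a, x) \<mapsto> a x\<close> and
  \<open>(a, x) \<mapsto> a x^2\<close> are multiplicative, and together they determine \<open>(a, x)\<close>. The inverse
  of this identification is \<open>(p, q) \<mapsto> (p q^(-1) p, p^(-1) q)\<close>
  (\<open>twist_iso\<close>). Under it the subgroup of pairs \<open>(b, 1)\<close> becomes the diagonal, and the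
  pair \<open>(x^n, x)\<close> becomes \<open>(x^(n+1), x^(n+2))\<close>. Inversion and conjugation by a diagonal
  element are now computed componentwise, and both preserve the shape \<open>(x^(n+1), x^(n+2))\<close>
  with the same \<open>n\<close>, replacing \<open>x\<close> by its inverse or by a conjugate. Since \<open>k\<close> does not
  distinguish \<open>x\<close> from these elements, the transversal is closed under both operations.

  For the right gyrogroup, write \<open>w\<close> for the product of \<open>y\<close> and \<open>z\<close> under the new operation.
  Solving \<open>(x o y) o z = u o w\<close> for \<open>u\<close> in \<open>G\<close> gives \<open>u = c^(-1) x d\<close> with
  \<open>c = y^k(y) z^k(z) w^(-k(w))\<close>, and the very definition of \<open>w\<close> forces \<open>d = c\<close>. So the
  gyration by \<open>y\<close> and \<open>z\<close> is conjugation by \<open>c\<close>. Conjugations are automorphisms of the new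
  operation because \<open>k\<close> is conjugation invariant; and if \<open>z = y^(-1)\<close> then \<open>w = 1\<close> and
  \<open>k(z) = k(y)\<close>, so that \<open>c = 1\<close>.
\<close>

section \<open>Group words and class assigned functions\<close>

context group
begin

lemma inv_cancel_left:
  "x \<in> carrier G \<Longrightarrow> y \<in> carrier G \<Longrightarrow> inv x \<otimes> (x \<otimes> y) = y"
  "x \<in> carrier G \<Longrightarrow> y \<in> carrier G \<Longrightarrow> x \<otimes> (inv x \<otimes> y) = y"
  by (simp_all flip: m_assoc)

text \<open>These rewrite rules reduce every group word to its free normal form.\<close>

lemmas group_word = m_assoc inv_mult_group inv_cancel_left

lemma conj_nat_pow:
  assumes "x \<in> carrier G" "b \<in> carrier G"
  shows "(inv b \<otimes> x \<otimes> b) [^] (n::nat) = inv b \<otimes> x [^] n \<otimes> b"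
  using assms by (induction n) (simp_all add: group_word)

lemma class_assigned_related:
  assumes "class_assigned G k" "(a, b) \<in> conj_inv_rel G"
  shows "k a = k b"
proof -
  have a: "a \<in> carrier G"
    using assms(2) by (simp add: conj_inv_rel_def)
  then have "conj_inv_rel G `` {a} \<in> carrier G // conj_inv_rel G"
    by (rule quotientI)
  moreover have "a \<in> conj_inv_rel G `` {a}" "b \<in> conj_inv_rel G `` {a}"
    using a assms(2) by (auto simp: conj_inv_rel_def)
  ultimately show ?thesis
    using assms(1) unfolding class_assigned_def by blast
qed

lemma class_assigned_inv:
  assumes "class_assigned G k" "x \<in> carrier G"
  shows "k (inv x) = k x"
  by (rule class_assigned_related[OF assms(1)]) (use assms(2) in \<open>simp add: conj_inv_rel_def\<close>)

lemma class_assigned_conj: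
  assumes "class_assigned G k" "x \<in> carrier G" "b \<in> carrier G"
  shows "k (inv b \<otimes> x \<otimes> b) = k x"
  by (rule class_assigned_related[OF assms(1)])
    (use assms(2,3) in \<open>auto simp: conj_inv_rel_def conjugate_def\<close>)


section \<open>The group of pairs as a direct product\<close>

text \<open>The inverse of \<open>(a, x) \<mapsto> (a x, a x\<^sup>2)\<close>.\<close>

definition twist :: "'a \<times> 'a \<Rightarrow> 'a \<times> 'a" where
  "twist = (\<lambda>(p, q). (p \<otimes> inv q \<otimes> p, inv p \<otimes> q))"

text \<open>
  This transports the group axioms to the pairs, and it makes inverses and conjugates of pairs
  computable without unfolding the twisted operation.
\<close>

lemma twist_iso: "twist \<in> iso (G \<times>\<times> G) (pair_group G)"
proof (rule isoI)
  show "twist \<in> hom (G \<times>\<times> G) (pair_group G)"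
    by (rule homI)
      (auto simp: twist_def pair_group_def commutator_def circ_def numeral_2_eq_2 group_word)
  show "bij_betw twist (carrier (G \<times>\<times> G)) (carrier (pair_group G))"
    by (rule bij_betw_byWitness[where f' = "\<lambda>(a, x). (a \<otimes> x, a \<otimes> x \<otimes> x)"])
      (auto simp: twist_def pair_group_def group_word)
qed

lemma carrier_pair_group: "carrier (pair_group G) = carrier G \<times> carrier G"
  by (simp add: pair_group_def)

lemma group_pair_group: "group (pair_group G)"
proof -
  have "group (pair_group G\<lparr>one := twist \<one>\<^bsub>G \<times>\<times> G\<^esub>\<rparr>)"
    using DirProd_group[OF is_group is_group] twist_iso by (rule group.iso_imp_img_group)
  then show ?thesis
    by (simp add: twist_def pair_group_def)
qed

lemma twist_group_hom: "group_hom (G \<times>\<times> G) (pair_group G) twist"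
  using DirProd_group[OF is_group is_group] group_pair_group twist_iso
  by (auto intro!: group_hom.intro simp: group_hom_axioms_def iso_def)

lemma twist_diagonal: "b \<in> carrier G \<Longrightarrow> twist (b, b) = (b, \<one>)"
  by (simp add: twist_def group_word)

text \<open>
  Taking powers commutes with inversion and conjugation in each component, so this form of the
  pair \<open>(x^n, x)\<close> shows that both operations keep the exponent \<open>n\<close>.
\<close>

lemma twist_consecutive_powers:
  assumes "x \<in> carrier G"
  shows "twist (x [^] Suc n, x [^] Suc (Suc n)) = (x [^] n, x)"
  using assms by (simp add: twist_def group_word)

lemma pair_group_inv_power:
  assumes x: "x \<in> carrier G"
  shows "inv\<^bsub>pair_group G\<^esub> (x [^] (n::nat), x) = (inv x [^] n, inv x)"
proof -
  interpret tw: group_hom "G \<times>\<times> G" "pair_group G" twist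
    by (rule twist_group_hom)
  have "inv\<^bsub>pair_group G\<^esub> (x [^] n, x) = twist (inv\<^bsub>G \<times>\<times> G\<^esub> (x [^] Suc n, x [^] Suc (Suc n)))"
    unfolding twist_consecutive_powers[OF x, symmetric]
    by (rule tw.hom_inv[symmetric]) (use x in simp)
  also have "\<dots> = twist (inv x [^] Suc n, inv x [^] Suc (Suc n))"
    using x by (simp only: inv_DirProd[OF is_group is_group] nat_pow_inv nat_pow_closed)
  finally show ?thesis
    using x by (simp only: twist_consecutive_powers inv_closed)
qed

lemma pair_group_conj_power:
  assumes x: "x \<in> carrier G" and b: "b \<in> carrier G"
  shows "inv\<^bsub>pair_group G\<^esub> (b, \<one>) \<otimes>\<^bsub>pair_group G\<^esub> (x [^] (n::nat), x) \<otimes>\<^bsub>pair_group G\<^esub> (b, \<one>)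
    = ((inv b \<otimes> x \<otimes> b) [^] n, inv b \<otimes> x \<otimes> b)"
proof -
  interpret tw: group_hom "G \<times>\<times> G" "pair_group G" twist
    by (rule twist_group_hom)
  let ?s = "(x [^] Suc n, x [^] Suc (Suc n))"
  have s: "?s \<in> carrier (G \<times>\<times> G)" and d: "(b, b) \<in> carrier (G \<times>\<times> G)"
    using x b by simp_all
  have "inv\<^bsub>pair_group G\<^esub> (b, \<one>) \<otimes>\<^bsub>pair_group G\<^esub> (x [^] n, x) \<otimes>\<^bsub>pair_group G\<^esub> (b, \<one>)
      = twist (inv\<^bsub>G \<times>\<times> G\<^esub> (b, b) \<otimes>\<^bsub>G \<times>\<times> G\<^esub> ?s \<otimes>\<^bsub>G \<times>\<times> G\<^esub> (b, b))"
    unfolding twist_consecutive_powers[OF x, symmetric] twist_diagonal[OF b, symmetric]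
    using s d by (simp only: tw.hom_mult tw.hom_inv tw.G.inv_closed tw.G.m_closed)
  also have "\<dots> = twist ((inv b \<otimes> x \<otimes> b) [^] Suc n, (inv b \<otimes> x \<otimes> b) [^] Suc (Suc n))"
    using x b
    by (simp only: inv_DirProd[OF is_group is_group] mult_DirProd conj_nat_pow nat_pow_closed)
  finally show ?thesis
    using x b by (simp only: twist_consecutive_powers inv_closed m_closed)
qed


section \<open>The transversal\<close>

lemma subgroup_first_factor: "subgroup (carrier G \<times> {\<one>}) (pair_group G)"
proof -
  interpret P: group "pair_group G"
    by (rule group_pair_group)
  show ?thesis
  proof (rule P.subgroupI)
    fix p assume "p \<in> carrier G \<times> {\<one>}"
    then obtain b where b: "b \<in> carrier G" "p = (b, \<one>)" by auto
    have "inv\<^bsub>pair_group G\<^esub> p = (inv b, \<one>)"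
      by (rule P.inv_equality) (use b in \<open>simp_all add: pair_group_def commutator_def circ_def\<close>)
    then show "inv\<^bsub>pair_group G\<^esub> p \<in> carrier G \<times> {\<one>}"
      using b by simp
  qed (auto simp: pair_group_def commutator_def circ_def)
qed

text \<open>
  Multiplying \<open>(a, x)\<close> by \<open>(b, 1)\<close> on the left only changes the first component, so a right
  coset is a fibre of the second projection.
\<close>

lemma rcoset_first_factor:
  assumes "a \<in> carrier G" "x \<in> carrier G"
  shows "(carrier G \<times> {\<one>}) #>\<^bsub>pair_group G\<^esub> (a, x) = carrier G \<times> {x}"
proof
  show "(carrier G \<times> {\<one>}) #>\<^bsub>pair_group G\<^esub> (a, x) \<subseteq> carrier G \<times> {x}"
    using assms by (auto simp: r_coset_def pair_group_def commutator_def circ_def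
        numeral_2_eq_2 group_word)
next
  have "(c, x) = (c \<otimes> inv a, \<one>) \<otimes>\<^bsub>pair_group G\<^esub> (a, x)" if "c \<in> carrier G" for c
    using that assms
    by (simp add: pair_group_def commutator_def circ_def numeral_2_eq_2 group_word)
  moreover have "c \<otimes> inv a \<in> carrier G" if "c \<in> carrier G" for c
    using that assms by simp
  ultimately show "carrier G \<times> {x} \<subseteq> (carrier G \<times> {\<one>}) #>\<^bsub>pair_group G\<^esub> (a, x)"
    unfolding r_coset_def by blast
qed

lemma right_transversal_graph:
  assumes "\<And>x. x \<in> carrier G \<Longrightarrow> g x \<in> carrier G"
  shows "right_transversal (pair_group G) (carrier G \<times> {\<one>}) {(g x, x) | x. x \<in> carrier G}"
  unfolding right_transversal_def
proof (intro conjI ballI)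
  fix C assume "C \<in> rcosets\<^bsub>pair_group G\<^esub> (carrier G \<times> {\<one>})"
  then obtain x where "x \<in> carrier G" "C = carrier G \<times> {x}"
    by (auto simp: RCOSETS_def rcoset_first_factor carrier_pair_group)
  then show "\<exists>!s. s \<in> {(g x, x) | x. x \<in> carrier G} \<inter> C"
    using assms by auto
next
  show "{(g x, x) | x. x \<in> carrier G} \<subseteq> carrier (pair_group G)"
    using assms by (auto simp: carrier_pair_group)
qed (rule group_pair_group subgroup_first_factor)+

lemma gyrotransversal_class_assigned_powers:
  assumes k: "class_assigned G k"
  shows "gyrotransversal (pair_group G) (carrier G \<times> {\<one>}) {(x [^] k x, x) | x. x \<in> carrier G}"
    (is "gyrotransversal _ ?H ?S")
  unfolding gyrotransversal_def
proof (intro conjI ballI)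
  show "right_transversal (pair_group G) ?H ?S"
    by (rule right_transversal_graph) simp
  show "\<one>\<^bsub>pair_group G\<^esub> \<in> ?S"
    by (auto simp: pair_group_def)
next
  have inv_S: "inv\<^bsub>pair_group G\<^esub> (x [^] k x, x) = (inv x [^] k (inv x), inv x)"
    if "x \<in> carrier G" for x
    using that by (simp add: pair_group_inv_power class_assigned_inv[OF k])
  show "?S = set_inv\<^bsub>pair_group G\<^esub> ?S"
  proof (intro subset_antisym subsetI)
    fix s assume "s \<in> ?S"
    then obtain x where x: "x \<in> carrier G" "s = (x [^] k x, x)" by auto
    then have "s = inv\<^bsub>pair_group G\<^esub> (inv x [^] k (inv x), inv x)"
      using inv_S[of "inv x"] by simp
    then show "s \<in> set_inv\<^bsub>pair_group G\<^esub> ?S"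
      using x(1) by (auto simp: SET_INV_def)
  next
    fix s assume "s \<in> set_inv\<^bsub>pair_group G\<^esub> ?S"
    then show "s \<in> ?S"
      by (auto simp: SET_INV_def inv_S)
  qed
next
  fix s h assume "s \<in> ?S" "h \<in> ?H"
  then obtain x b where x: "x \<in> carrier G" "s = (x [^] k x, x)"
    and b: "b \<in> carrier G" "h = (b, \<one>)" by auto
  let ?y = "inv b \<otimes> x \<otimes> b"
  have "inv\<^bsub>pair_group G\<^esub> h \<otimes>\<^bsub>pair_group G\<^esub> s \<otimes>\<^bsub>pair_group G\<^esub> h = (?y [^] k ?y, ?y)"
    using x b by (simp add: pair_group_conj_power class_assigned_conj[OF k])
  then show "inv\<^bsub>pair_group G\<^esub> h \<otimes>\<^bsub>pair_group G\<^esub> s \<otimes>\<^bsub>pair_group G\<^esub> h \<in> ?S"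
    using x b by auto
qed


section \<open>The right gyrogroup\<close>

lemma gyro_op_magma_simps:
  "carrier (gyro_op_magma G k) = carrier G"
  "\<one>\<^bsub>gyro_op_magma G k\<^esub> = \<one>"
  "y \<in> carrier G \<Longrightarrow> x \<otimes>\<^bsub>gyro_op_magma G k\<^esub> y = inv (y [^] k y) \<otimes> x \<otimes> (y [^] k y \<otimes> y)"
  by (simp_all add: gyro_op_magma_def int_pow_neg_int)

lemma gyro_op_closed:
  "x \<in> carrier G \<Longrightarrow> y \<in> carrier G \<Longrightarrow> x \<otimes>\<^bsub>gyro_op_magma G k\<^esub> y \<in> carrier G"
  by (simp add: gyro_op_magma_simps)

lemma gyro_op_right_cancel:
  assumes "u \<in> carrier G" "v \<in> carrier G" "w \<in> carrier G"
    and "u \<otimes>\<^bsub>gyro_op_magma G k\<^esub> w = v \<otimes>\<^bsub>gyro_op_magma G k\<^esub> w"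
  shows "u = v"
  using assms by (simp add: gyro_op_magma_simps)

definition gyration_conjugator :: "('a \<Rightarrow> nat) \<Rightarrow> 'a \<Rightarrow> 'a \<Rightarrow> 'a" where
  "gyration_conjugator k y z =
     (let w = y \<otimes>\<^bsub>gyro_op_magma G k\<^esub> z in y [^] k y \<otimes> z [^] k z \<otimes> inv (w [^] k w))"

lemma gyration_conjugator_closed:
  "y \<in> carrier G \<Longrightarrow> z \<in> carrier G \<Longrightarrow> gyration_conjugator k y z \<in> carrier G"
  by (simp add: gyration_conjugator_def Let_def gyro_op_closed)

text \<open>
  Solving for the left factor on the right-hand side gives \<open>c^(-1) x d\<close> with
  \<open>d = y^(k(y)+1) z^(k(z)+1) w^(-k(w)-1)\<close>, where \<open>w\<close> is the product of \<open>y\<close> and \<open>z\<close>.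
  Since \<open>w = z^(-k(z)) y z^(k(z)+1)\<close>, the extra factors \<open>y\<close>, \<open>z\<close> and \<open>w^(-1)\<close> in \<open>d\<close>
  cancel, which leaves \<open>d = c\<close>.
\<close>

lemma gyro_op_assoc_up_to_conj:
  fixes k :: "'a \<Rightarrow> nat"
  assumes x: "x \<in> carrier G" and y: "y \<in> carrier G" and z: "z \<in> carrier G"
  defines "c \<equiv> gyration_conjugator k y z"
  shows "(x \<otimes>\<^bsub>gyro_op_magma G k\<^esub> y) \<otimes>\<^bsub>gyro_op_magma G k\<^esub> z
    = (inv c \<otimes> x \<otimes> c) \<otimes>\<^bsub>gyro_op_magma G k\<^esub> (y \<otimes>\<^bsub>gyro_op_magma G k\<^esub> z)"
proof -
  define w where "w = y \<otimes>\<^bsub>gyro_op_magma G k\<^esub> z"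
  have w: "w \<in> carrier G"
    unfolding w_def using y z by (rule gyro_op_closed)
  define p where "p = y [^] k y"
  define q where "q = z [^] k z"
  define r where "r = w [^] k w"
  have pqr: "p \<in> carrier G" "q \<in> carrier G" "r \<in> carrier G"
    using y z w by (simp_all add: p_def q_def r_def)
  have c: "c = p \<otimes> q \<otimes> inv r"
    by (simp add: c_def gyration_conjugator_def Let_def w_def p_def q_def r_def)
  have w_eq: "w = inv q \<otimes> y \<otimes> (q \<otimes> z)"
    using z by (simp add: w_def q_def gyro_op_magma_simps)
  have "(inv c \<otimes> x \<otimes> c) \<otimes>\<^bsub>gyro_op_magma G k\<^esub> w = inv r \<otimes> (inv c \<otimes> x \<otimes> c) \<otimes> (r \<otimes> w)"
    using w by (simp add: gyro_op_magma_simps r_def)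
  \<comment> \<open>The outer powers of \<open>w\<close> cancel against \<open>c\<close>, and only the last factor \<open>w\<close> survives.\<close>
  also have "\<dots> = inv q \<otimes> (inv p \<otimes> x \<otimes> (p \<otimes> q)) \<otimes> w"
    using x w pqr by (simp add: c group_word)
  also have "\<dots> = inv q \<otimes> (inv p \<otimes> x \<otimes> (p \<otimes> y)) \<otimes> (q \<otimes> z)"
    using x y z pqr by (simp add: w_eq group_word)
  also have "\<dots> = (x \<otimes>\<^bsub>gyro_op_magma G k\<^esub> y) \<otimes>\<^bsub>gyro_op_magma G k\<^esub> z"
    using y z by (simp add: gyro_op_magma_simps p_def q_def)
  finally show ?thesis
    by (simp add: w_def)
qed

lemma gyro_op_left_quotient_unique:
  assumes "x \<in> carrier G" "y \<in> carrier G" "z \<in> carrier G"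
  shows "\<exists>!u. u \<in> carrier (gyro_op_magma G k) \<and>
    (x \<otimes>\<^bsub>gyro_op_magma G k\<^esub> y) \<otimes>\<^bsub>gyro_op_magma G k\<^esub> z
      = u \<otimes>\<^bsub>gyro_op_magma G k\<^esub> (y \<otimes>\<^bsub>gyro_op_magma G k\<^esub> z)"
proof (rule ex_ex1I)
  let ?c = "gyration_conjugator k y z"
  have "inv ?c \<otimes> x \<otimes> ?c \<in> carrier (gyro_op_magma G k)"
    using assms by (simp add: gyro_op_magma_simps(1) gyration_conjugator_closed)
  then show "\<exists>u. u \<in> carrier (gyro_op_magma G k) \<and>
      (x \<otimes>\<^bsub>gyro_op_magma G k\<^esub> y) \<otimes>\<^bsub>gyro_op_magma G k\<^esub> z
        = u \<otimes>\<^bsub>gyro_op_magma G k\<^esub> (y \<otimes>\<^bsub>gyro_op_magma G k\<^esub> z)"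
    using gyro_op_assoc_up_to_conj[OF assms] by blast
qed (metis gyro_op_right_cancel gyro_op_closed gyro_op_magma_simps(1) assms(2,3))

lemma gyr_eq_conj:
  assumes "x \<in> carrier G" "y \<in> carrier G" "z \<in> carrier G"
  shows "gyr (gyro_op_magma G k) y z x
    = inv (gyration_conjugator k y z) \<otimes> x \<otimes> gyration_conjugator k y z"
  unfolding gyr_def
  by (rule the1_equality[OF gyro_op_left_quotient_unique[OF assms]])
    (use assms in \<open>simp add: gyro_op_magma_simps(1) gyration_conjugator_closed
      gyro_op_assoc_up_to_conj\<close>)

text \<open>
  The operation is a group word whose exponents depend on \<open>k y\<close> only; conjugation respects
  group words and does not change \<open>k y\<close>.
\<close>

lemma conj_iso_gyro_op:
  assumes k: "class_assigned G k" and c: "c \<in> carrier G"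
  shows "(\<lambda>x. inv c \<otimes> x \<otimes> c) \<in> iso (gyro_op_magma G k) (gyro_op_magma G k)"
proof (rule isoI)
  show "(\<lambda>x. inv c \<otimes> x \<otimes> c) \<in> hom (gyro_op_magma G k) (gyro_op_magma G k)"
  proof (rule homI)
    fix x y
    assume "x \<in> carrier (gyro_op_magma G k)" "y \<in> carrier (gyro_op_magma G k)"
    then have x: "x \<in> carrier G" and y: "y \<in> carrier G"
      by (simp_all add: gyro_op_magma_simps(1))
    have "(inv c \<otimes> y \<otimes> c) [^] k (inv c \<otimes> y \<otimes> c) = inv c \<otimes> y [^] k y \<otimes> c"
      by (simp add: class_assigned_conj[OF k y c] conj_nat_pow[OF y c])
    then show "inv c \<otimes> (x \<otimes>\<^bsub>gyro_op_magma G k\<^esub> y) \<otimes> c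
        = (inv c \<otimes> x \<otimes> c) \<otimes>\<^bsub>gyro_op_magma G k\<^esub> (inv c \<otimes> y \<otimes> c)"
      using x y c by (simp add: gyro_op_magma_simps(3) group_word)
  qed (use c in \<open>simp add: gyro_op_magma_simps(1)\<close>)
  show "bij_betw (\<lambda>x. inv c \<otimes> x \<otimes> c) (carrier (gyro_op_magma G k)) (carrier (gyro_op_magma G k))"
    by (rule bij_betw_byWitness[where f' = "\<lambda>x. c \<otimes> x \<otimes> inv c"])
      (use c in \<open>auto simp: gyro_op_magma_simps(1) group_word\<close>)
qed

lemma gyr_iso:
  assumes k: "class_assigned G k" and y: "y \<in> carrier G" and z: "z \<in> carrier G"
  shows "gyr (gyro_op_magma G k) y z \<in> iso (gyro_op_magma G k) (gyro_op_magma G k)"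
proof -
  let ?M = "gyro_op_magma G k"
  let ?c = "gyration_conjugator k y z"
  let ?f = "\<lambda>x. inv ?c \<otimes> x \<otimes> ?c"
  have gyr_eq: "gyr ?M y z x = ?f x" if "x \<in> carrier ?M" for x
    using that y z by (simp add: gyr_eq_conj gyro_op_magma_simps(1))
  have closed: "x \<otimes>\<^bsub>?M\<^esub> x' \<in> carrier ?M" if "x \<in> carrier ?M" "x' \<in> carrier ?M" for x x'
    using that by (simp add: gyro_op_closed gyro_op_magma_simps(1))
  have f: "?f \<in> iso ?M ?M"
    using k gyration_conjugator_closed[OF y z] by (rule conj_iso_gyro_op)
  show ?thesis
  proof (rule isoI)
    show "gyr ?M y z \<in> hom ?M ?M"
      using f by (intro homI) (simp_all add: gyr_eq closed iso_def hom_def Pi_def)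
    show "bij_betw (gyr ?M y z) (carrier ?M) (carrier ?M)"
      using f bij_betw_cong[of "carrier ?M" "gyr ?M y z" ?f, OF gyr_eq] by (simp add: iso_def)
  qed
qed

lemma gyro_op_inv:
  assumes "class_assigned G k" "y \<in> carrier G"
  shows "y \<otimes>\<^bsub>gyro_op_magma G k\<^esub> inv y = \<one>"
proof -
  have "y [^] k y \<otimes> y = y \<otimes> y [^] k y"
    using assms(2) by (metis nat_pow_Suc nat_pow_Suc2)
  moreover have "y \<otimes>\<^bsub>gyro_op_magma G k\<^esub> inv y = (y [^] k y \<otimes> y) \<otimes> inv (y \<otimes> y [^] k y)"
    using assms by (simp add: gyro_op_magma_simps class_assigned_inv inv_mult_group nat_pow_inv)
  ultimately show ?thesis
    using assms(2) by simp
qed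

lemma gyr_inv:
  assumes k: "class_assigned G k" and x: "x \<in> carrier G" and y: "y \<in> carrier G"
  shows "gyr (gyro_op_magma G k) y (inv y) x = x"
proof -
  have "gyration_conjugator k y (inv y) = \<one>"
    using y by (simp add: gyration_conjugator_def Let_def gyro_op_inv[OF k y]
        class_assigned_inv[OF k y] nat_pow_inv)
  then show ?thesis
    using x y by (simp add: gyr_eq_conj)
qed

lemma right_gyrogroup_gyro_op:
  assumes k: "class_assigned G k"
  shows "right_gyrogroup (gyro_op_magma G k)"
  unfolding right_gyrogroup_def
proof (intro conjI ballI bexI[where x = "\<lambda>a. inv a"])
  fix x y z
  assume "x \<in> carrier (gyro_op_magma G k)" "y \<in> carrier (gyro_op_magma G k)"
    "z \<in> carrier (gyro_op_magma G k)"
  then show "\<exists>!u. u \<in> carrier (gyro_op_magma G k) \<and>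
      (x \<otimes>\<^bsub>gyro_op_magma G k\<^esub> y) \<otimes>\<^bsub>gyro_op_magma G k\<^esub> z
        = u \<otimes>\<^bsub>gyro_op_magma G k\<^esub> (y \<otimes>\<^bsub>gyro_op_magma G k\<^esub> z)"
    by (intro gyro_op_left_quotient_unique) (simp_all add: gyro_op_magma_simps(1))
qed (auto simp: gyro_op_magma_simps(1,2) gyro_op_closed gyro_op_inv[OF k] gyr_iso[OF k]
    gyr_inv[OF k], simp add: gyro_op_magma_simps)

end

theorem theorem3p7:
  fixes G :: "('a, 'b) monoid_scheme" and k :: "'a \<Rightarrow> nat" and g :: "'a \<Rightarrow> 'a"
  assumes "group G" and "\<not> comm_group G"
    and "class_assigned G k"
    and "\<And>w. w \<in> carrier G \<Longrightarrow> g w = w [^]\<^bsub>G\<^esub> k w"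
  shows "gyrotransversal (pair_group G) (carrier G \<times> {\<one>\<^bsub>G\<^esub>}) {(g x, x) | x. x \<in> carrier G} \<and>
    right_gyrogroup (gyro_op_magma G k)"
proof
  interpret group G
    by (rule assms(1))
  have "{(g x, x) | x. x \<in> carrier G} = {(x [^]\<^bsub>G\<^esub> k x, x) | x. x \<in> carrier G}"
    using assms(4) by auto
  then show "gyrotransversal (pair_group G) (carrier G \<times> {\<one>\<^bsub>G\<^esub>}) {(g x, x) | x. x \<in> carrier G}"
    using gyrotransversal_class_assigned_powers[OF assms(3)] by simp
  show "right_gyrogroup (gyro_op_magma G k)"
    using assms(3) by (rule right_gyrogroup_gyro_op)
qed

end
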